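(* Let $(M,g)$ be the Walker 3-manifold with metric $g$ determined by $\varepsilon\in\{1,-1\}$ and a smooth function $f$. Let $\mathcal{F}$ be a smooth function on $M$ depending on the three variables $x,y,z$, and let $\lambda$ be a real constant. 1. $(M,g,\nabla\mathcal{F},0,\lambda,0)$ (that is, $\beta=\mu=0$) is a gradient Ricci-Yamabe soliton if and only if there exist functions $F,a,b,c$ of the variable $z$, with $F$ nowhere zero, such that $$\mathcal{F}(x,y,z)=F(z)x-\frac{\varepsilon\lambda}{2}y^2+a(z)y+b(z),$$ $$f(x,y,z)=\frac{2y\,\partial_za(z)+2\,\partial_zb(z)}{F(z)}+\frac{2(\lambda+F'(z))}{F(z)}x+c(z),$$ and $$\partial_{zz}\mathcal{F}-\frac12\left(f\,\partial_xf+\partial_zf\right)\partial_x\mathcal{F}+\frac1{2\varepsilon}\partial_yf\,\partial_y\mathcal{F}+\frac12\partial_xf\,\partial_z\mathcal{F}=-\lambda f.$$ 2. For a nonzero real constant $\mu$, $(M,g,\nabla\mathcal{F},0,\lambda,\mu)$ (that is, $\beta=0$) is a gradient Ricci-Yamabe soliton if and only if there exist functions $F,F_4,F_5$ of the variable $z$, with $F$ nowhere zero, and a function $F_2$ of the variables $(y,z)$ such that $\mathcal{F}(x,y,z)=F(z)x+F_2(y,z)$, $$f(x,y,z)=\frac{2\,\partial_zF_2(y,z)}{F(z)}+\frac{\varepsilon\lambda+\partial_{yy}F_2(y,z)}{\varepsilon\mu}x^2+F_4(z)x+F_5(z),$$ and $$\begin{cases}\partial_{xz}\mathcal{F}-\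frac12\partial_xf\,\partial_x\mathcal{F}=-\lambda+\frac\mu2\partial_{xx}f,\\[4pt]\partial_{zz}\mathcal{F}-\frac12\left(f\,\partial_xf+\partial_zf\right)\partial_x\mathcal{F}+\frac1{2\varepsilon}\partial_yf\,\partial_y\mathcal{F}+\frac12\partial_xf\,\partial_z\mathcal{F}=\left(-\lambda+\frac\mu2\partial_{xx}f\right)f.\end{cases}$$
   Context: $M$ is a 3-manifold with coordinates $(x,y,z)=(x^1,x^2,x^3)$, $\varepsilon\in\{1,-1\}$, $f=f(x,y,z)$ is a smooth function, and the Walker metric $g$ has matrix $g_{13}=g_{31}=1$, $g_{22}=\varepsilon$, $g_{33}=f$, all other entries $0$. All functions are smooth. $\operatorname{Ric}$ is the Ricci tensor and $\operatorname{Scal}$ the scalar curvature of $g$; with $f_{,ij}=\partial^2 f/\partial x^i\partial x^j$: $\operatorname{Ric}_{13}=\tfrac12 f_{,11}$, $\operatorname{Ric}_{23}=\tfrac12 f_{,12}$, $\operatorname{Ric}_{33}=\frac{\varepsilon f f_{,11}-f_{,22}}{2\varepsilon}$, $\operatorname{Ric}_{11}=\operatorname{Ric}_{12}=\operatorname{Ric}_{22}=0$, and $\operatorname{Scal}=f_{,11}$. For a smooth function $\mathcal{F}$ and real constants $\beta,\lambda,\mu$, $(M,g,\nabla\mathcal{F},\beta,\lambda,\mu)$ is a gradient Ricci-Yamabe soliton if $2\beta\operatorname{Ric}+2\nabla^2\mathcal{F}=(-2\lambda+\mu\operatorname{Scal})\,g$, where $\nabla^2\mathcal{F}$ is the Hessian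 of $\mathcal{F}$ with respect to $g$.
   Formalization: M is taken to be an open convex coordinate domain in R^3, and "depending on x,y,z" is read as the x-derivative of the potential being nowhere zero on M; without these the equivalence fails, e.g. f=0 with potential -λxz-(ελ/2)y^2, λ≠0, on R^3. *)

theory Defs
  imports "HOL-Analysis.Analysis"
begin

section \<open>Smooth functions\<close>

text \<open>The derivative is taken along the line through the point, so for a point of an open set it
  depends only on the values of the function near that point.\<close>

definition dir_deriv :: "'a::real_normed_vector \<Rightarrow> ('a \<Rightarrow> real) \<Rightarrow> 'a \<Rightarrow> real" where
  "dir_deriv v h p = deriv (\<lambda>t. h (p + t *\<^sub>R v)) 0"

text \<open>Infinite differentiability, meant for open sets: all iterated partial derivatives, of any
  order (including 0) and in any sequence of coordinate directions, are Frechet differentiable.\<close>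

definition smooth_on :: "'a::euclidean_space set \<Rightarrow> ('a \<Rightarrow> real) \<Rightarrow> bool" where
  "smooth_on S h \<longleftrightarrow> (\<forall>bs. set bs \<subseteq> Basis \<longrightarrow> foldr dir_deriv bs h differentiable_on S)"

section \<open>Pseudo-Riemannian geometry in a coordinate domain\<close>

text \<open>A metric is given by its matrix in the coordinates, as a function of the point.\<close>

definition partial :: "'n::finite \<Rightarrow> (real ^ 'n \<Rightarrow> real) \<Rightarrow> real ^ 'n \<Rightarrow> real" where
  "partial i = dir_deriv (axis i 1)"

text \<open>\<open>christoffel g k i j\<close> is \<open>\<Gamma>\<^sup>k\<^sub>i\<^sub>j\<close> of the Levi-Civita connection.\<close>

definition christoffel ::
    "(real ^ 'n \<Rightarrow> real ^ 'n ^ 'n) \<Rightarrow> 'n::finite \<Rightarrow> 'n \<Rightarrow> 'n \<Rightarrow> real ^ 'n \<Rightarrow> real" where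
  "christoffel g k i j p =
     (1/2) * (\<Sum>l\<in>UNIV. matrix_inv (g p) $ k $ l *
       (partial i (\<lambda>q. g q $ j $ l) p + partial j (\<lambda>q. g q $ i $ l) p
          - partial l (\<lambda>q. g q $ i $ j) p))"

text \<open>\<open>riemann g l k i j\<close> is the component along \<open>\<partial>\<^sub>l\<close> of \<open>R(\<partial>\<^sub>i, \<partial>\<^sub>j)\<partial>\<^sub>k\<close>, where
  \<open>R(X, Y) = [\<nabla>\<^sub>X, \<nabla>\<^sub>Y] - \<nabla>\<^bsub>[X, Y]\<^esub>\<close>.\<close>

definition riemann ::
    "(real ^ 'n \<Rightarrow> real ^ 'n ^ 'n) \<Rightarrow> 'n::finite \<Rightarrow> 'n \<Rightarrow> 'n \<Rightarrow> 'n \<Rightarrow> real ^ 'n \<Rightarrow> real" where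
  "riemann g l k i j p =
     partial i (christoffel g l j k) p - partial j (christoffel g l i k) p
     + (\<Sum>m\<in>UNIV. christoffel g l i m p * christoffel g m j k p
                 - christoffel g l j m p * christoffel g m i k p)"

text \<open>\<open>Ric(Y, Z)\<close> is the trace of \<open>X \<mapsto> R(X, Y)Z\<close>.\<close>

definition ricci :: "(real ^ 'n \<Rightarrow> real ^ 'n ^ 'n) \<Rightarrow> real ^ 'n \<Rightarrow> real ^ 'n::finite ^ 'n" where
  "ricci g p = (\<chi> j k. \<Sum>i\<in>UNIV. riemann g i k i j p)"

definition scalar_curvature :: "(real ^ 'n \<Rightarrow> real ^ 'n ^ 'n) \<Rightarrow> real ^ 'n::finite \<Rightarrow> real" where
  "scalar_curvature g p = (\<Sum>i\<in>UNIV. \<Sum>j\<in>UNIV. matrix_inv (g p) $ i $ j * ricci g p $ i $ j)"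

definition hessian ::
    "(real ^ 'n \<Rightarrow> real ^ 'n ^ 'n) \<Rightarrow> (real ^ 'n \<Rightarrow> real) \<Rightarrow> real ^ 'n \<Rightarrow> real ^ 'n::finite ^ 'n" where
  "hessian g h p =
     (\<chi> i j. partial i (partial j h) p - (\<Sum>k\<in>UNIV. christoffel g k i j p * partial k h p))"

definition gradient_ricci_yamabe_soliton ::
    "(real ^ 'n) set \<Rightarrow> (real ^ 'n \<Rightarrow> real ^ 'n ^ 'n) \<Rightarrow> (real ^ 'n::finite \<Rightarrow> real)
       \<Rightarrow> real \<Rightarrow> real \<Rightarrow> real \<Rightarrow> bool" where
  "gradient_ricci_yamabe_soliton M g h \<beta> lam \<mu> \<longleftrightarrow>
     (\<forall>p\<in>M. (2 * \<beta>) *\<^sub>R ricci g p + 2 *\<^sub>R hessian g h p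
             = (- 2 * lam + \<mu> * scalar_curvature g p) *\<^sub>R g p)"

section \<open>Walker metrics in dimension three\<close>

definition walker_metric :: "real \<Rightarrow> (real ^ 3 \<Rightarrow> real) \<Rightarrow> real ^ 3 \<Rightarrow> real ^ 3 ^ 3" where
  "walker_metric \<epsilon> f p =
     vector [vector [0, 0, 1],
             vector [0, \<epsilon>, 0],
             vector [1, 0, f p]]"

text \<open>The values taken on \<open>M\<close> by \<open>z\<close> and by \<open>(y, z)\<close>: the domains of functions of these
  variables.\<close>

definition z_range :: "(real ^ 3) set \<Rightarrow> real set" where
  "z_range M = (\<lambda>p. p $ 3) ` M"

definition yz_range :: "(real ^ 3) set \<Rightarrow> (real \<times> real) set" where
  "yz_range M = (\<lambda>p. (p $ 2, p $ 3)) ` M"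

end

theory Submission
  imports Defs
begin

text \<open>
  With \<open>s = - lam + \<mu> / 2 \<cdot> \<partial>\<^sub>1\<partial>\<^sub>1f\<close>, the soliton condition for \<open>\<beta> = 0\<close> says that the Hessian of the potential
  \<open>h\<close> is \<open>s\<close> times the metric. Its components \<open>(1, 1)\<close> and \<open>(1, 2)\<close> say that \<open>\<partial>\<^sub>1h\<close> depends on \<open>z\<close> only,
  so \<open>h\<close> is affine in \<open>x\<close>. The components \<open>(1, 3)\<close> and \<open>(2, 3)\<close> determine \<open>\<partial>\<^sub>1f\<close> and \<open>\<partial>\<^sub>2f\<close>. Each
  coefficient function is found by writing it as a smooth function on \<open>M\<close> in terms of \<open>h\<close>, \<open>f\<close> and their
  partial derivatives, and by checking that its derivatives in the other variables vanish; by convexity it then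
  descends to a smooth function of the remaining variables. Conversely, all components but \<open>(3, 3)\<close>
  are recovered by differentiating the closed forms. For \<open>\<mu> \<noteq> 0\<close> the form of \<open>f\<close> allows a term quadratic
  in \<open>x\<close>, but differentiating component \<open>(1, 3)\<close> in \<open>x\<close> shows that its coefficient is zero.
\<close>

section \<open>Directional derivatives and smooth functions\<close>

text \<open>The chain rule along the line through \<open>p\<close>. It is the bridge from the
  one-variable \<open>deriv\<close> to Frechet derivatives, and all later differentiation rules are
  transferred through it.\<close>

lemma dir_deriv_eq:
  assumes "(u has_derivative D) (at p)"
  shows "dir_deriv v u p = D v"
proof -
  have "((\<lambda>t. u (p + t *\<^sub>R v)) has_derivative (\<lambda>t. D (t *\<^sub>R v))) (at 0)"
    by (rule has_derivative_compose[of "\<lambda>t. p + t *\<^sub>R v" _ 0 UNIV u D])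
       (auto intro!: derivative_eq_intros assms)
  moreover have "(\<lambda>t. D (t *\<^sub>R v)) = (\<lambda>t. D v * t)"
    using linear_scale[OF has_derivative_linear[OF assms]] by (simp add: mult.commute)
  ultimately show ?thesis
    unfolding dir_deriv_def by (intro DERIV_imp_deriv) (simp add: has_field_derivative_def)
qed

text \<open>By \<open>dir_deriv_eq\<close>, any Frechet derivative at \<open>p\<close> must be this
  map. In particular \<open>dir_deriv v u p\<close> is then linear in \<open>v\<close>.\<close>

lemma has_derivative_frechet:
  "u differentiable (at p) \<Longrightarrow> (u has_derivative (\<lambda>v. dir_deriv v u p)) (at p)"
  unfolding differentiable_def by (metis (lifting) ext dir_deriv_eq)

lemma has_real_derivative_line:
  assumes "u differentiable (at (p + t *\<^sub>R v))"
  shows "((\<lambda>s. u (p + s *\<^sub>R v)) has_real_derivative dir_deriv v u (p + t *\<^sub>R v)) (at t)"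
proof -
  let ?D = "\<lambda>w. dir_deriv w u (p + t *\<^sub>R v)"
  have D: "(u has_derivative ?D) (at (p + t *\<^sub>R v))"
    using assms by (rule has_derivative_frechet)
  have "((\<lambda>s. u (p + s *\<^sub>R v)) has_derivative (\<lambda>s. ?D (s *\<^sub>R v))) (at t)"
    by (rule has_derivative_compose[of "\<lambda>t. p + t *\<^sub>R v" _ t UNIV u ?D])
       (auto intro!: derivative_eq_intros D)
  moreover have "(\<lambda>s. ?D (s *\<^sub>R v)) = (\<lambda>s. ?D v * s)"
    using linear_scale[OF has_derivative_linear[OF D]] by (simp add: mult.commute)
  ultimately show ?thesis
    by (simp add: has_field_derivative_def)
qed

text \<open>Openness keeps \<open>p + t *\<^sub>R v\<close> in \<open>S\<close> for small
  \<open>t\<close>. Equations known only on \<open>S\<close> can therefore be differentiated,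
  whatever the functions do elsewhere.\<close>

lemma dir_deriv_cong:
  assumes "open S" "p \<in> S" "\<And>q. q \<in> S \<Longrightarrow> u q = w q"
  shows "dir_deriv v u p = dir_deriv v w p"
proof -
  have "((\<lambda>t::real. p + t *\<^sub>R v) \<longlongrightarrow> p + 0 *\<^sub>R v) (at 0)"
    by (intro tendsto_intros)
  then have "\<forall>\<^sub>F t in at (0::real). p + t *\<^sub>R v \<in> S"
    using assms(1,2) by (simp add: topological_tendstoD)
  then have "\<forall>\<^sub>F t in nhds (0::real). u (p + t *\<^sub>R v) = w (p + t *\<^sub>R v)"
    using assms(2,3) by (auto simp: eventually_at_filter elim!: eventually_mono)
  then show ?thesis
    unfolding dir_deriv_def by (rule deriv_cong_ev) simp
qed

lemma dir_deriv_const [simp]: "dir_deriv v (\<lambda>_. c) p = 0"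
  by (simp add: dir_deriv_def)

lemma dir_deriv_add:
  assumes "u differentiable (at p)" "w differentiable (at p)"
  shows "dir_deriv v (\<lambda>q. u q + w q) p = dir_deriv v u p + dir_deriv v w p"
  using dir_deriv_eq[OF has_derivative_add[OF has_derivative_frechet has_derivative_frechet, OF assms]] .

lemma dir_deriv_mult:
  assumes "u differentiable (at p)" "w differentiable (at p)"
  shows "dir_deriv v (\<lambda>q. u q * w q) p = u p * dir_deriv v w p + dir_deriv v u p * w p"
  using dir_deriv_eq[OF has_derivative_mult[OF has_derivative_frechet has_derivative_frechet, OF assms]] .

lemma dir_deriv_inverse:
  assumes "u differentiable (at p)" "u p \<noteq> 0"
  shows "dir_deriv v (\<lambda>q. inverse (u q)) p = - (inverse (u p) * dir_deriv v u p * inverse (u p))"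
  using dir_deriv_eq[OF Deriv.has_derivative_inverse[OF assms(2) has_derivative_frechet[OF assms(1)]]] .

section \<open>Closure properties of smooth functions\<close>

lemma smooth_on_differentiable:
  assumes "open S" "smooth_on S u" "p \<in> S"
  shows "u differentiable (at p)"
proof -
  have "u differentiable_on S"
    using assms(2)[unfolded smooth_on_def, rule_format, of "[]"] by simp
  then show ?thesis
    using assms by (simp add: differentiable_on_eq_differentiable_at)
qed

lemma smooth_on_dir_deriv:
  assumes "smooth_on S u" "b \<in> Basis"
  shows "smooth_on S (dir_deriv b u)"
  unfolding smooth_on_def
proof (intro allI impI)
  fix bs :: "'a list" assume "set bs \<subseteq> Basis"
  then show "foldr dir_deriv bs (dir_deriv b u) differentiable_on S"
    using assms(1)[unfolded smooth_on_def, rule_format, of "bs @ [b]"] assms(2) by simp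
qed

text \<open>The algebra generated by the smooth functions is closed under partial derivatives and consists
  of differentiable functions, so it contains only smooth functions. This gives all closure
  properties of \<open>smooth_on\<close> at once.\<close>

inductive smooth_alg :: "'a::euclidean_space set \<Rightarrow> ('a \<Rightarrow> real) \<Rightarrow> bool" for S where
  smooth: "smooth_on S u \<Longrightarrow> smooth_alg S u"
| add: "smooth_alg S u \<Longrightarrow> smooth_alg S w \<Longrightarrow> smooth_alg S (\<lambda>q. u q + w q)"
| mult: "smooth_alg S u \<Longrightarrow> smooth_alg S w \<Longrightarrow> smooth_alg S (\<lambda>q. u q * w q)"
| inverse: "smooth_alg S u \<Longrightarrow> (\<And>q. q \<in> S \<Longrightarrow> u q \<noteq> 0) \<Longrightarrow> smooth_alg S (\<lambda>q. inverse (u q))"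
| cong: "smooth_alg S u \<Longrightarrow> (\<And>q. q \<in> S \<Longrightarrow> u q = w q) \<Longrightarrow> smooth_alg S w"

lemma foldr_dir_deriv_const: "foldr dir_deriv bs (\<lambda>_. c) \<in> range (\<lambda>c _. c)"
proof (induction bs)
  case (Cons b bs)
  then obtain d where "foldr dir_deriv bs (\<lambda>_. c) = (\<lambda>_. d)" by blast
  moreover have "dir_deriv b (\<lambda>_. d) = (\<lambda>_. 0)" by (simp add: fun_eq_iff)
  ultimately show ?case by simp
qed simp

lemma smooth_on_const: "smooth_on S (\<lambda>_. c)"
  unfolding smooth_on_def
proof (intro allI impI)
  fix bs :: "'a list"
  obtain d where "foldr dir_deriv bs (\<lambda>_. c) = (\<lambda>_. d)"
    using foldr_dir_deriv_const by blast
  then show "foldr dir_deriv bs (\<lambda>_. c) differentiable_on S" by simp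
qed

lemma smooth_alg_differentiable:
  assumes S: "open S"
  shows "smooth_alg S u \<Longrightarrow> p \<in> S \<Longrightarrow> u differentiable (at p)"
proof (induction rule: smooth_alg.induct)
  case (smooth u)
  then show ?case using smooth_on_differentiable S by blast
next
  case (cong u w)
  then obtain D where "(u has_derivative D) (at p)" unfolding differentiable_def by blast
  then have "(w has_derivative D) (at p)"
    using cong S by (blast intro: has_derivative_transform_within_open)
  then show ?case unfolding differentiable_def by blast
next
  case (inverse u)
  then show ?case by (auto intro!: differentiable_inverse)
qed (auto intro!: derivative_intros)

text \<open>Induction with the sum, product and reciprocal rules. These rules hold only at points of
  \<open>S\<close>, so the clause \<open>cong\<close> is what replaces a derivative by the
  expression computed for it.\<close>

lemma smooth_alg_dir_deriv:
  assumes S: "open S" and b: "b \<in> Basis"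
  shows "smooth_alg S u \<Longrightarrow> smooth_alg S (dir_deriv b u)"
proof (induction rule: smooth_alg.induct)
  case (smooth u)
  then show ?case using b by (intro smooth_alg.smooth smooth_on_dir_deriv)
next
  case (add u w)
  then show ?case
    by (intro smooth_alg.cong[OF smooth_alg.add[OF add.IH]])
       (simp add: dir_deriv_add smooth_alg_differentiable[OF S])
next
  case (mult u w)
  show ?case
    by (rule smooth_alg.cong[OF smooth_alg.add[OF smooth_alg.mult[OF mult.hyps(1) mult.IH(2)]
            smooth_alg.mult[OF mult.IH(1) mult.hyps(2)]]])
       (use mult in \<open>simp add: dir_deriv_mult smooth_alg_differentiable[OF S]\<close>)
next
  case (inverse u)
  have "smooth_alg S (\<lambda>q. inverse (u q))"
    using inverse smooth_alg.inverse by blast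
  \<comment> \<open>Negation is not among the generating operations, so the sign is supplied by a
    constant factor.\<close>
  then have "smooth_alg S (\<lambda>q. - 1 * (inverse (u q) * dir_deriv b u q * inverse (u q)))"
    by (intro smooth_alg.mult inverse.IH smooth_alg.smooth[OF smooth_on_const])
  then show ?case
    by (rule smooth_alg.cong)
       (use inverse in \<open>simp add: dir_deriv_inverse smooth_alg_differentiable[OF S]\<close>)
next
  case (cong u w)
  show ?case
    by (rule smooth_alg.cong[OF cong.IH]) (use cong S in \<open>blast intro: dir_deriv_cong\<close>)
qed

lemma smooth_alg_imp_smooth_on:
  assumes S: "open S" and u: "smooth_alg S u"
  shows "smooth_on S u"
proof -
  have "smooth_alg S (foldr dir_deriv bs u)" if "set bs \<subseteq> Basis" for bs
    using that by (induction bs) (simp_all add: u smooth_alg_dir_deriv[OF S])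
  then show ?thesis
    unfolding smooth_on_def differentiable_on_eq_differentiable_at[OF S]
    using smooth_alg_differentiable[OF S] by blast
qed

lemma
  assumes S: "open S"
  shows smooth_on_add: "smooth_on S u \<Longrightarrow> smooth_on S w \<Longrightarrow> smooth_on S (\<lambda>q. u q + w q)"
    and smooth_on_mult: "smooth_on S u \<Longrightarrow> smooth_on S w \<Longrightarrow> smooth_on S (\<lambda>q. u q * w q)"
    and smooth_on_inverse: "smooth_on S u \<Longrightarrow> (\<And>q. q \<in> S \<Longrightarrow> u q \<noteq> 0) \<Longrightarrow>
      smooth_on S (\<lambda>q. inverse (u q))"
  using smooth_alg.add[OF smooth_alg.smooth smooth_alg.smooth, of S u w]
    smooth_alg.mult[OF smooth_alg.smooth smooth_alg.smooth, of S u w]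
    smooth_alg.inverse[OF smooth_alg.smooth, of S u] smooth_alg_imp_smooth_on[OF S]
  by simp_all

lemma
  assumes S: "open S"
  shows smooth_on_minus: "smooth_on S u \<Longrightarrow> smooth_on S (\<lambda>q. - u q)"
    and smooth_on_diff: "smooth_on S u \<Longrightarrow> smooth_on S w \<Longrightarrow> smooth_on S (\<lambda>q. u q - w q)"
    and smooth_on_divide: "smooth_on S u \<Longrightarrow> smooth_on S w \<Longrightarrow> (\<And>q. q \<in> S \<Longrightarrow> w q \<noteq> 0) \<Longrightarrow>
      smooth_on S (\<lambda>q. u q / w q)"
proof -
  show minus: "smooth_on S (\<lambda>q. - u q)" if "smooth_on S u" for u
    using smooth_on_mult[OF S smooth_on_const[of S "- 1"] that] by simp
  show "smooth_on S (\<lambda>q. u q - w q)" if "smooth_on S u" "smooth_on S w"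
    using smooth_on_add[OF S that(1) minus[OF that(2)]] by simp
  show "smooth_on S (\<lambda>q. u q / w q)"
    if "smooth_on S u" "smooth_on S w" "\<And>q. q \<in> S \<Longrightarrow> w q \<noteq> 0"
    using smooth_on_mult[OF S that(1) smooth_on_inverse[OF S that(2,3)]]
    by (simp add: divide_inverse)
qed

section \<open>Symmetry of second derivatives\<close>

text \<open>The mean value theorem is applied twice, first in direction \<open>v\<close> and then in
  direction \<open>w\<close>. The bounds on the norms and on \<open>h\<close> keep the whole
  parallelogram inside the ball.\<close>

lemma second_difference:
  assumes u: "\<And>q. q \<in> ball p r \<Longrightarrow> u differentiable (at q)"
    and du: "\<And>q. q \<in> ball p r \<Longrightarrow> dir_deriv v u differentiable (at q)"
    and vw: "norm v \<le> 1" "norm w \<le> 1" and h: "0 < h" "2 * h < r"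
  obtains q where "q \<in> ball p r"
    "u (p + h *\<^sub>R v + h *\<^sub>R w) - u (p + h *\<^sub>R v) - u (p + h *\<^sub>R w) + u p
       = h * h * dir_deriv w (dir_deriv v u) q"
proof -
  have in_ball: "p + s *\<^sub>R v + t *\<^sub>R w \<in> ball p r" if "0 \<le> s" "s \<le> h" "0 \<le> t" "t \<le> h" for s t
  proof -
    have "norm (s *\<^sub>R v + t *\<^sub>R w) \<le> s * norm v + t * norm w"
      using that norm_triangle_ineq[of "s *\<^sub>R v" "t *\<^sub>R w"] by simp
    also have "\<dots> \<le> h * 1 + h * 1"
      using that vw h by (intro add_mono mult_mono) auto
    finally show ?thesis
      using h dist_add_cancel[of p 0 "s *\<^sub>R v + t *\<^sub>R w"] by (simp add: add.assoc)
  qed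
  \<comment> \<open>The second difference is \<open>\<phi> h - \<phi> 0\<close>, the increment in
    direction \<open>v\<close> of a difference in direction \<open>w\<close>.\<close>
  define \<phi> where "\<phi> s = u ((p + h *\<^sub>R w) + s *\<^sub>R v) - u (p + s *\<^sub>R v)" for s
  define \<phi>' where
    "\<phi>' s = dir_deriv v u ((p + h *\<^sub>R w) + s *\<^sub>R v) - dir_deriv v u (p + s *\<^sub>R v)" for s
  have "(\<phi> has_real_derivative \<phi>' s) (at s)" if "0 \<le> s" "s \<le> h" for s
    unfolding \<phi>_def \<phi>'_def
    by (intro DERIV_diff has_real_derivative_line u)
       (use in_ball[of s h] in_ball[of s 0] that h in \<open>auto simp: add_ac\<close>)
  then obtain s where s: "0 < s" "s < h" "\<phi> h - \<phi> 0 = (h - 0) * \<phi>' s"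
    using MVT2[of 0 h \<phi> \<phi>'] h by blast
  \<comment> \<open>\<open>\<phi>' s\<close> is itself an increment in direction \<open>w\<close>,
    now of the derivative in direction \<open>v\<close>; this calls for the second mean value
    point.\<close>
  define \<psi> where "\<psi> t = dir_deriv v u ((p + s *\<^sub>R v) + t *\<^sub>R w)" for t
  define \<psi>' where "\<psi>' t = dir_deriv w (dir_deriv v u) ((p + s *\<^sub>R v) + t *\<^sub>R w)" for t
  have "(\<psi> has_real_derivative \<psi>' t) (at t)" if "0 \<le> t" "t \<le> h" for t
    unfolding \<psi>_def \<psi>'_def
    by (intro has_real_derivative_line du) (use in_ball[of s t] that s in auto)
  then obtain t where t: "0 < t" "t < h" "\<psi> h - \<psi> 0 = (h - 0) * \<psi>' t"
    using MVT2[of 0 h \<psi> \<psi>'] h by blast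
  have "\<phi>' s = \<psi> h - \<psi> 0"
    by (simp add: \<phi>'_def \<psi>_def add_ac)
  then have "\<phi> h - \<phi> 0 = h * h * \<psi>' t"
    using s t by simp
  then have "u (p + h *\<^sub>R v + h *\<^sub>R w) - u (p + h *\<^sub>R v) - u (p + h *\<^sub>R w) + u p = h * h * \<psi>' t"
    by (simp add: \<phi>_def add_ac)
  then show ?thesis
    using that in_ball[of s t] s t unfolding \<psi>'_def by simp
qed

text \<open>The second difference is symmetric in \<open>v\<close> and \<open>w\<close>, so the two
  mixed derivatives agree at two points close to \<open>p\<close>. Both are continuous, being
  differentiable, hence they differ at \<open>p\<close> by less than any \<open>e\<close>.\<close>

lemma dir_deriv_commute:
  assumes S: "open S" "p \<in> S" and u: "smooth_on S u" and vw: "v \<in> Basis" "w \<in> Basis"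
  shows "dir_deriv v (dir_deriv w u) p = dir_deriv w (dir_deriv v u) p"
proof -
  let ?A = "dir_deriv v (dir_deriv w u)" and ?B = "dir_deriv w (dir_deriv v u)"
  note smooth = u smooth_on_dir_deriv[OF u] smooth_on_dir_deriv[OF smooth_on_dir_deriv[OF u]]
  have "\<bar>?A p - ?B p\<bar> < e" if "0 < e" for e
  proof -
    obtain r0 where r0: "0 < r0" "ball p r0 \<subseteq> S"
      using S by (metis open_contains_ball)
    have "isCont ?A p" "isCont ?B p"
      using vw S by (auto intro!: differentiable_imp_continuous_within
          smooth_on_differentiable[OF S(1)] smooth)
    then obtain r1 r2 where r1: "0 < r1" "\<And>q. dist q p < r1 \<Longrightarrow> dist (?A q) (?A p) < e / 2"
      and r2: "0 < r2" "\<And>q. dist q p < r2 \<Longrightarrow> dist (?B q) (?B p) < e / 2"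
      using \<open>0 < e\<close> by (metis continuous_at half_gt_zero continuous_at_eps_delta)
    define r where "r = min r0 (min r1 r2)"
    define h where "h = r / 3"
    have h: "0 < h" "2 * h < r" and r: "ball p r \<subseteq> S"
      using r0 r1 r2 by (auto simp: h_def r_def subset_iff)
    have diff: "w differentiable (at q)" if "smooth_on S w" "q \<in> ball p r" for w q
      using smooth_on_differentiable[OF S(1)] r that by blast
    obtain q where q: "q \<in> ball p r"
      "u (p + h *\<^sub>R w + h *\<^sub>R v) - u (p + h *\<^sub>R w) - u (p + h *\<^sub>R v) + u p = h * h * ?A q"
      using second_difference[of p r u w v h] diff smooth vw h by auto
    obtain q' where q': "q' \<in> ball p r"
      "u (p + h *\<^sub>R v + h *\<^sub>R w) - u (p + h *\<^sub>R v) - u (p + h *\<^sub>R w) + u p = h * h * ?B q'"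
      using second_difference[of p r u v w h] diff smooth vw h by auto
    have "h * h * ?A q = h * h * ?B q'"
      using q(2) q'(2) by (simp add: algebra_simps)
    then have "?A q = ?B q'"
      using h by simp
    moreover have "dist (?A q) (?A p) < e / 2"
      using q(1) by (intro r1(2)) (simp add: r_def dist_commute)
    moreover have "dist (?B q') (?B p) < e / 2"
      using q'(1) by (intro r2(2)) (simp add: r_def dist_commute)
    ultimately show ?thesis
      unfolding dist_real_def by argo
  qed
  \<comment> \<open>If the difference were nonzero, taking it as \<open>e\<close> would make it
    smaller than itself.\<close>
  from this[of "\<bar>?A p - ?B p\<bar>"] show ?thesis by auto
qed

section \<open>Vanishing derivatives and factorization through linear maps\<close>

text \<open>By convexity the segment from \<open>p\<close> to \<open>q\<close> stays in
  \<open>S\<close>, and \<open>u\<close> is constant on it. Only the coordinates in which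
  \<open>p\<close> and \<open>q\<close> differ enter its direction.\<close>

lemma eq_if_dir_deriv_zero:
  fixes u :: "'a::euclidean_space \<Rightarrow> real"
  assumes S: "open S" "convex S" and u: "smooth_on S u" and pq: "p \<in> S" "q \<in> S"
    and zero: "\<And>b x. b \<in> Basis \<Longrightarrow> (q - p) \<bullet> b \<noteq> 0 \<Longrightarrow> x \<in> S \<Longrightarrow> dir_deriv b u x = 0"
  shows "u p = u q"
proof -
  have in_S: "p + t *\<^sub>R (q - p) \<in> S" if "0 \<le> t" "t \<le> 1" for t
    using convexD_alt[OF S(2) pq that] by (simp add: algebra_simps)
  have "dir_deriv (q - p) u x = 0" if "x \<in> S" for x
  proof -
    let ?D = "\<lambda>v. dir_deriv v u x"
    have lin: "linear ?D"
      using has_derivative_linear has_derivative_frechet smooth_on_differentiable[OF S(1) u that]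
      by blast
    \<comment> \<open>In each summand either the coordinate of \<open>q - p\<close> is zero or the
      derivative vanishes by \<open>zero\<close>.\<close>
    have "?D (\<Sum>b\<in>Basis. ((q - p) \<bullet> b) *\<^sub>R b) = (\<Sum>b\<in>Basis. ((q - p) \<bullet> b) * ?D b)"
      by (simp add: linear_sum[OF lin] linear_scale[OF lin])
    also have "\<dots> = 0"
      using zero that by (intro sum.neutral) auto
    finally show ?thesis
      by (simp add: euclidean_representation)
  qed
  then have "((\<lambda>t. u (p + t *\<^sub>R (q - p))) has_real_derivative 0) (at t within {0..1})"
    if "t \<in> {0..1}" for t
    using has_real_derivative_line[of u p t "q - p"] smooth_on_differentiable[OF S(1) u] in_S[of t] that
    by (simp add: has_field_derivative_at_within)
  then obtain c where "\<forall>t\<in>{0..1}. u (p + t *\<^sub>R (q - p)) = c"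
    using has_field_derivative_zero_constant[of "{0..1::real}" "\<lambda>t. u (p + t *\<^sub>R (q - p))"] by auto
  from bspec[OF this, of 0] bspec[OF this, of 1] show ?thesis by simp
qed

text \<open>\<open>\<pi>\<close> sends the line through \<open>p\<close> in direction
  \<open>v\<close> to the line through \<open>\<pi> p\<close> in direction \<open>\<pi> v\<close>,
  so near \<open>t = 0\<close> both sides differentiate the same function of
  \<open>t\<close>.\<close>

lemma dir_deriv_linear_factor:
  assumes \<pi>: "linear \<pi>" and S: "open S" "p \<in> S" and u: "\<And>q. q \<in> S \<Longrightarrow> u q = h (\<pi> q)"
  shows "dir_deriv v u p = dir_deriv (\<pi> v) h (\<pi> p)"
proof -
  have "dir_deriv v u p = dir_deriv v (\<lambda>q. h (\<pi> q)) p"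
    using S u by (rule dir_deriv_cong)
  then show ?thesis
    by (simp add: dir_deriv_def linear_add[OF \<pi>] linear_scale[OF \<pi>])
qed

text \<open>The section \<open>\<sigma>\<close> sends basis vectors to basis vectors, so each
  iterated derivative of \<open>h\<close>, composed with \<open>\<pi>\<close>, is an iterated
  derivative of \<open>u\<close>. It remains to see that a function whose composition with
  \<open>\<pi>\<close> is smooth is itself differentiable.\<close>

lemma smooth_on_linear_factor:
  fixes \<pi> :: "'a::euclidean_space \<Rightarrow> 'b::euclidean_space"
  assumes \<pi>: "linear \<pi>" and \<sigma>: "linear \<sigma>" "\<And>y. \<pi> (\<sigma> y) = y" "\<sigma> ` Basis \<subseteq> Basis"
    and S: "open S" and u: "smooth_on S u" "\<And>q. q \<in> S \<Longrightarrow> u q = h (\<pi> q)"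
  shows "smooth_on (\<pi> ` S) h"
proof -
  have "surj \<pi>" using \<sigma>(2) by (metis surjI)
  then have open_image: "open (\<pi> ` S)"
    using open_surjective_linear_image S \<pi> by blast
  have "smooth_on S (foldr dir_deriv (map \<sigma> bs) u) \<and>
      (\<forall>q\<in>S. foldr dir_deriv (map \<sigma> bs) u q = foldr dir_deriv bs h (\<pi> q))"
    if "set bs \<subseteq> Basis" for bs
    using that
  proof (induction bs)
    case (Cons b bs)
    then show ?case
      using \<sigma> dir_deriv_linear_factor[OF \<pi> S, where v = "\<sigma> b"]
      by (auto intro!: smooth_on_dir_deriv)
  qed (use u in auto)
  moreover have "k differentiable (at (\<pi> p))"
    if w: "smooth_on S w" "\<And>q. q \<in> S \<Longrightarrow> w q = k (\<pi> q)" and p: "p \<in> S" for w p and k :: "'b \<Rightarrow> real"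
  proof -
    \<comment> \<open>The affine section through \<open>p\<close>. It maps a neighbourhood of
      \<open>\<pi> p\<close> into \<open>S\<close>, where \<open>k\<close> is recovered as
      \<open>w\<close> composed with \<open>\<tau>\<close>.\<close>
    define \<tau> where "\<tau> y = p + \<sigma> (y - \<pi> p)" for y
    have \<tau>: "(\<tau> has_derivative \<sigma>) (at (\<pi> p))"
      unfolding \<tau>_def using \<sigma>(1)
      by (auto intro!: derivative_eq_intros linear_imp_has_derivative
          has_derivative_compose[of "\<lambda>y. y - \<pi> p" _ _ UNIV \<sigma>])
    have [simp]: "\<tau> (\<pi> p) = p"
      using linear_0[OF \<sigma>(1)] by (simp add: \<tau>_def)
    have "(w has_derivative (\<lambda>v. dir_deriv v w p)) (at (\<tau> (\<pi> p)))"
      using has_derivative_frechet smooth_on_differentiable[OF S w(1) p] by simp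
    note has_derivative_compose[OF \<tau> this]
    moreover have "\<forall>\<^sub>F y in at (\<pi> p). \<tau> y \<in> S"
    proof (rule topological_tendstoD)
      show "(\<tau> \<longlongrightarrow> p) (at (\<pi> p))"
        using has_derivative_continuous[OF \<tau>] by (simp add: continuous_within)
    qed (use S p in auto)
    then have "\<forall>\<^sub>F y in at (\<pi> p). w (\<tau> y) = k y"
    proof (rule eventually_mono)
      fix y assume "\<tau> y \<in> S"
      moreover have "\<pi> (\<tau> y) = y"
        by (simp add: \<tau>_def linear_add[OF \<pi>] \<sigma>(2))
      ultimately show "w (\<tau> y) = k y" using w(2) by simp
    qed
    ultimately have "(k has_derivative (\<lambda>v. dir_deriv (\<sigma> v) w p)) (at (\<pi> p))"
      by (rule has_derivative_transform_eventually) (use w p in auto)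
    then show ?thesis unfolding differentiable_def by blast
  qed
  ultimately show ?thesis
    unfolding smooth_on_def differentiable_on_eq_differentiable_at[OF open_image] by blast
qed

section \<open>Functions of some of the coordinates\<close>

lemma axis_1_in_Basis [simp]: "axis i (1::real) \<in> Basis"
  by (auto simp: Basis_vec_def)

lemma smooth_on_partial: "smooth_on S u \<Longrightarrow> smooth_on S (partial i u)"
  by (simp add: partial_def smooth_on_dir_deriv)

lemma smooth_on_nth: "smooth_on S (\<lambda>q::real^'n. q $ j)"
  for S :: "(real ^ 'n) set"
proof -
  have D: "((\<lambda>q::real^'n. q $ j) has_derivative (\<lambda>v. v $ j)) (at p)" for p
    by (rule bounded_linear_imp_has_derivative) (rule bounded_linear_vec_nth)
  have "foldr dir_deriv bs (\<lambda>q::real^'n. q $ j) differentiable_on S" for bs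
  \<comment> \<open>\<open>foldr\<close> applies the last direction first. That derivative is
    already constant, so the list is split at its end.\<close>
  proof (cases bs rule: rev_cases)
    case Nil
    then show ?thesis
      using D by (auto simp: differentiable_on_def differentiable_def intro: has_derivative_at_withinI)
  next
    case (snoc bs' b)
    have "dir_deriv b (\<lambda>q::real^'n. q $ j) = (\<lambda>_. b $ j)"
      using dir_deriv_eq[OF D] by blast
    then show ?thesis
      using smooth_on_const[of S "b $ j"] foldr_dir_deriv_const[of bs' "b $ j"] snoc by auto
  qed
  then show ?thesis by (simp add: smooth_on_def)
qed

lemma partial_const [simp]: "partial i (\<lambda>_. c) p = 0"
  by (simp add: partial_def)

lemma partial_nth: "partial i (\<lambda>q::real^'n. q $ j) p = (if i = j then 1 else 0)"
proof -
  have "((\<lambda>q::real^'n. q $ j) has_derivative (\<lambda>v. v $ j)) (at p)"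
    by (rule bounded_linear_imp_has_derivative) (rule bounded_linear_vec_nth)
  from dir_deriv_eq[OF this] show ?thesis
    by (simp add: partial_def axis_def)
qed

lemma partial_cong:
  assumes "open S" "p \<in> S" "\<forall>q\<in>S. u q = w q"
  shows "partial i u p = partial i w p"
  using dir_deriv_cong[OF assms(1,2), of u w] assms(3) by (simp add: partial_def)

lemma
  assumes S: "open S" "p \<in> S"
  shows partial_add: "smooth_on S u \<Longrightarrow> smooth_on S w \<Longrightarrow>
      partial i (\<lambda>q. u q + w q) p = partial i u p + partial i w p"
    and partial_mult: "smooth_on S u \<Longrightarrow> smooth_on S w \<Longrightarrow>
      partial i (\<lambda>q. u q * w q) p = u p * partial i w p + partial i u p * w p"
  unfolding partial_def
  by (rule dir_deriv_add dir_deriv_mult; rule smooth_on_differentiable[OF S(1) _ S(2)]; assumption)+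

lemma partial_cmult:
  assumes S: "open S" "p \<in> S" and u: "smooth_on S u"
  shows "partial i (\<lambda>q. c * u q) p = c * partial i u p"
  using partial_mult[OF S smooth_on_const u, of i c] by simp

lemma
  assumes S: "open S" "p \<in> S"
  shows partial_minus: "smooth_on S u \<Longrightarrow> partial i (\<lambda>q. - u q) p = - partial i u p"
    and partial_diff: "smooth_on S u \<Longrightarrow> smooth_on S w \<Longrightarrow>
      partial i (\<lambda>q. u q - w q) p = partial i u p - partial i w p"
proof -
  show minus: "partial i (\<lambda>q. - u q) p = - partial i u p" if "smooth_on S u" for u
    using partial_cmult[OF S that, of i "- 1"] by simp
  show "partial i (\<lambda>q. u q - w q) p = partial i u p - partial i w p"
    if "smooth_on S u" "smooth_on S w"
    using partial_add[OF S that(1) smooth_on_minus[OF S(1) that(2)], of i] minus[OF that(2)] by simp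
qed

lemma partial_divide:
  assumes S: "open S" "p \<in> S" and uw: "smooth_on S u" "smooth_on S w"
    and nz: "\<And>q. q \<in> S \<Longrightarrow> w q \<noteq> 0"
  shows "partial i (\<lambda>q. u q / w q) p = (partial i u p * w p - u p * partial i w p) / (w p)\<^sup>2"
proof -
  have "partial i (\<lambda>q. inverse (w q)) p = - (inverse (w p) * partial i w p * inverse (w p))"
    unfolding partial_def
    by (intro dir_deriv_inverse smooth_on_differentiable[OF S(1) uw(2) S(2)] nz S)
  then have "partial i (\<lambda>q. u q * inverse (w q)) p
      = u p * - (inverse (w p) * partial i w p * inverse (w p)) + partial i u p * inverse (w p)"
    using partial_mult[OF S uw(1) smooth_on_inverse[OF S(1) uw(2) nz], of i] by simp
  then show ?thesis
    using nz[OF S(2)] by (simp add: field_simps power2_eq_square)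
qed

lemma partial_commute:
  assumes "open S" "p \<in> S" "smooth_on S u"
  shows "partial i (partial j u) p = partial j (partial i u) p"
  unfolding partial_def by (intro dir_deriv_commute[OF assms]) simp_all

section \<open>Functions of \<open>z\<close> and of \<open>(y, z)\<close>\<close>

lemma deriv_shift: "deriv (\<lambda>t. h (z + t)) 0 = deriv h (z::real)"
  unfolding deriv_def by (simp add: DERIV_shift[of h _ 0 z, unfolded add_0] add.commute)

text \<open>Applies \<open>dir_deriv_linear_factor\<close> to the projection to \<open>z\<close>.
  This translates between \<open>partial\<close> and the one-variable \<open>deriv\<close> in which
  the closed forms are stated.\<close>

lemma
  fixes S :: "(real ^ 3) set"
  assumes S: "open S" "p \<in> S" and u: "\<forall>q\<in>S. u q = h (q $ 3)"
  shows partial_3_function_of_z: "partial 3 u p = deriv h (p $ 3)" (is ?th3)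
    and partial_1_function_of_z: "partial 1 u p = 0" (is ?th1)
    and partial_2_function_of_z: "partial 2 u p = 0" (is ?th2)
proof -
  have "linear (\<lambda>q::real^3. q $ 3)"
    by (simp add: linear_iff)
  note eq = dir_deriv_linear_factor[where h = h, OF this S bspec[OF u]]
  show ?th1 ?th2 ?th3
    using eq[of "axis 1 1"] eq[of "axis 2 1"] eq[of "axis 3 1"]
    by (simp_all add: partial_def axis_def) (simp_all add: dir_deriv_def deriv_shift)
qed

lemma
  fixes S :: "(real ^ 3) set"
  assumes S: "open S" "p \<in> S" and u: "\<forall>q\<in>S. u q = h (q $ 2) (q $ 3)"
  shows partial_3_function_of_yz: "partial 3 u p = deriv (\<lambda>t. h (p $ 2) t) (p $ 3)" (is ?th3)
    and partial_2_function_of_yz: "partial 2 u p = deriv (\<lambda>s. h s (p $ 3)) (p $ 2)" (is ?th2)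
    and partial_1_function_of_yz: "partial 1 u p = 0" (is ?th1)
proof -
  have "linear (\<lambda>q::real^3. (q $ 2, q $ 3))"
    by (simp add: linear_iff)
  note eq = dir_deriv_linear_factor[where h = "\<lambda>(y, z). h y z" and u = u, OF this S, simplified, OF bspec[OF u]]
  show ?th1 ?th2 ?th3
    using eq[of "axis 1 1"] eq[of "axis 2 1"] eq[of "axis 3 1"]
    using deriv_shift[of "\<lambda>s. h s (p $ 3)" "p $ 2"]
    by (simp_all add: partial_def axis_def) (simp_all add: dir_deriv_def deriv_shift)
qed

text \<open>Two points with equal \<open>z\<close> are joined by a segment in the convex set
  \<open>M\<close> on which only \<open>x\<close> and \<open>y\<close> vary, so \<open>u\<close> is
  constant on each slice. Smoothness descends along the section \<open>axis 3\<close>.\<close>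

lemma descend_to_z:
  assumes M: "open M" "convex M" and u: "smooth_on M u"
    and zero: "\<forall>p\<in>M. partial 1 u p = 0" "\<forall>p\<in>M. partial 2 u p = 0"
  shows "\<exists>h. smooth_on (z_range M) h \<and> (\<forall>p\<in>M. u p = h (p $ 3))"
proof -
  \<comment> \<open>Any point of the slice serves; outside \<open>z_range M\<close> the value is
    arbitrary and carries no information.\<close>
  define h where "h z = u (SOME p. p \<in> M \<and> p $ 3 = z)" for z
  have h: "u p = h (p $ 3)" if "p \<in> M" for p
  proof -
    let ?q = "SOME q. q \<in> M \<and> q $ 3 = p $ 3"
    have q: "?q \<in> M \<and> ?q $ 3 = p $ 3"
      using that by (intro someI[of "\<lambda>q. q \<in> M \<and> q $ 3 = p $ 3" p]) simp
    have "u p = u ?q"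
    proof (rule eq_if_dir_deriv_zero[OF M u that])
      fix b x assume "b \<in> Basis" "(?q - p) \<bullet> b \<noteq> 0" "x \<in> M"
      then show "dir_deriv b u x = 0"
        using q zero by (auto simp: Basis_vec_def inner_axis partial_def UNIV_3)
    qed (use q in simp)
    then show ?thesis by (simp add: h_def)
  qed
  have "smooth_on ((\<lambda>p::real^3. p $ 3) ` M) h"
    by (rule smooth_on_linear_factor[where \<sigma> = "axis 3" and S = M and u = u])
       (use M u h in \<open>auto simp: linear_iff axis_def vec_eq_iff Basis_vec_def\<close>)
  then show ?thesis
    using h by (auto simp: z_range_def)
qed

text \<open>As for \<open>descend_to_z\<close>, with segments parallel to the \<open>x\<close> axis
  and the \<open>(y, z)\<close> plane embedded in space as section.\<close>

lemma descend_to_yz: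
  assumes M: "open M" "convex M" and u: "smooth_on M u"
    and zero: "\<forall>p\<in>M. partial 1 u p = 0"
  shows "\<exists>h. smooth_on (yz_range M) (\<lambda>(y, z). h y z) \<and> (\<forall>p\<in>M. u p = h (p $ 2) (p $ 3))"
proof -
  let ?P = "\<lambda>y z p. p \<in> M \<and> p $ 2 = y \<and> p $ 3 = z"
  define h where "h y z = u (SOME p. ?P y z p)" for y z
  have h: "u p = h (p $ 2) (p $ 3)" if "p \<in> M" for p
  proof -
    let ?q = "SOME q. ?P (p $ 2) (p $ 3) q"
    have q: "?P (p $ 2) (p $ 3) ?q"
      using that by (intro someI[of "?P (p $ 2) (p $ 3)" p]) simp
    have "u p = u ?q"
    proof (rule eq_if_dir_deriv_zero[OF M u that])
      fix b x assume "b \<in> Basis" "(?q - p) \<bullet> b \<noteq> 0" "x \<in> M"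
      then show "dir_deriv b u x = 0"
        using q zero by (auto simp: Basis_vec_def inner_axis partial_def UNIV_3)
    qed (use q in simp)
    then show ?thesis by (simp add: h_def)
  qed
  have "smooth_on ((\<lambda>p::real^3. (p $ 2, p $ 3)) ` M) (\<lambda>(y, z). h y z)"
    by (rule smooth_on_linear_factor[where \<sigma> = "\<lambda>(y, z). axis 2 y + axis 3 z" and S = M and u = u])
       (use M u h in \<open>auto simp: linear_iff axis_def vec_eq_iff Basis_vec_def Basis_prod_def\<close>)
  then show ?thesis
    using h by (auto simp: yz_range_def)
qed


section \<open>Pullback of smooth functions along coordinate projections\<close>

text \<open>A coordinate direction is either killed by \<open>\<pi>\<close> or sent to a coordinate
  direction. Hence each iterated derivative of the composition either vanishes on \<open>S\<close>
  or is again a smooth function composed with \<open>\<pi>\<close>.\<close>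

lemma smooth_on_linear_compose:
  fixes \<pi> :: "'a::euclidean_space \<Rightarrow> 'b::euclidean_space"
  assumes \<pi>: "linear \<pi>" "\<pi> ` Basis \<subseteq> insert 0 Basis" "surj \<pi>"
    and S: "open S" and h: "smooth_on (\<pi> ` S) h"
  shows "smooth_on S (\<lambda>q. h (\<pi> q))"
proof -
  have open_image: "open (\<pi> ` S)"
    using open_surjective_linear_image S \<pi> by blast
  have zero: "dir_deriv 0 k p = 0" for k :: "'b \<Rightarrow> real" and p
    by (simp add: dir_deriv_def)
  have P: "(\<forall>q\<in>S. foldr dir_deriv bs (\<lambda>q. h (\<pi> q)) q = 0) \<or>
      (\<exists>k. smooth_on (\<pi> ` S) k \<and> (\<forall>q\<in>S. foldr dir_deriv bs (\<lambda>q. h (\<pi> q)) q = k (\<pi> q)))"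
    (is "?P (foldr dir_deriv bs (\<lambda>q. h (\<pi> q)))") if "set bs \<subseteq> Basis" for bs
    using that
  proof (induction bs)
    case (Cons b bs)
    let ?u = "foldr dir_deriv bs (\<lambda>q. h (\<pi> q))"
    have "?P ?u"
      using Cons by simp
    then consider "\<forall>q\<in>S. ?u q = 0" | k where "smooth_on (\<pi> ` S) k" "\<forall>q\<in>S. ?u q = k (\<pi> q)"
      by blast
    then show ?case
    proof cases
      case 1
      then have "\<forall>q\<in>S. dir_deriv b ?u q = 0"
        using dir_deriv_cong[OF S, of _ ?u "\<lambda>_. 0" b] by simp
      then show ?thesis by simp
    next
      case 2
      then have eq: "\<forall>q\<in>S. dir_deriv b ?u q = dir_deriv (\<pi> b) k (\<pi> q)"
        using dir_deriv_linear_factor[OF \<pi>(1) S, of _ ?u k b] by simp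
      show ?thesis
      proof (cases "\<pi> b = 0")
        case True
        with eq zero show ?thesis by simp
      next
        case False
        then have "\<pi> b \<in> Basis"
          using \<pi>(2) Cons.prems by auto
        then show ?thesis
          using eq smooth_on_dir_deriv[OF 2(1)]
          by (intro disjI2 exI[of _ "dir_deriv (\<pi> b) k"]) simp
      qed
    qed
  next
    case Nil
    have "\<forall>q\<in>S. foldr dir_deriv [] (\<lambda>q. h (\<pi> q)) q = h (\<pi> q)" by simp
    with h show ?case by blast
  qed
  have diff: "u differentiable (at p)" if u: "?P u" and p: "p \<in> S" for u p
    using u
  proof
    assume zero: "\<forall>q\<in>S. u q = 0"
    have "0 = u q" if "q \<in> S" for q
      by (rule bspec[OF zero that, symmetric])
    then have "(u has_derivative (\<lambda>_. 0)) (at p)"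
      by (rule has_derivative_transform_within_open[OF has_derivative_const S p])
    then show ?thesis by (rule differentiableI)
  next
    assume "\<exists>k. smooth_on (\<pi> ` S) k \<and> (\<forall>q\<in>S. u q = k (\<pi> q))"
    then obtain k where k: "smooth_on (\<pi> ` S) k \<and> (\<forall>q\<in>S. u q = k (\<pi> q))" ..
    have "k differentiable (at (\<pi> p))"
      using smooth_on_differentiable[OF open_image conjunct1[OF k]] p by simp
    then have "(k has_derivative (\<lambda>v. dir_deriv v k (\<pi> p))) (at (\<pi> p))"
      by (rule has_derivative_frechet)
    with linear_imp_has_derivative[OF \<pi>(1)]
    have "((\<lambda>q. k (\<pi> q)) has_derivative (\<lambda>v. dir_deriv (\<pi> v) k (\<pi> p))) (at p)"
      by (rule has_derivative_compose)
    then have "(u has_derivative (\<lambda>v. dir_deriv (\<pi> v) k (\<pi> p))) (at p)"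
      using S p bspec[OF conjunct2[OF k], symmetric] by (rule has_derivative_transform_within_open)
    then show ?thesis by (rule differentiableI)
  qed
  show ?thesis
    unfolding smooth_on_def differentiable_on_eq_differentiable_at[OF S]
    by (intro allI impI ballI) (rule diff[OF P])
qed

lemma smooth_on_function_of_z:
  assumes "open M" "smooth_on (z_range M) h"
  shows "smooth_on M (\<lambda>p. h (p $ 3))"
proof -
  have "linear (\<lambda>p::real^3. p $ 3)" "(\<lambda>p::real^3. p $ 3) ` Basis \<subseteq> insert 0 Basis"
    "surj (\<lambda>p::real^3. p $ 3)"
    by (auto simp: linear_iff axis_def Basis_vec_def intro!: surjI[of _ "axis 3"] split: if_splits)
  from smooth_on_linear_compose[OF this assms[unfolded z_range_def]] show ?thesis .
qed

lemma smooth_on_function_of_yz: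
  assumes "open M" "smooth_on (yz_range M) (\<lambda>(y, z). h y z)"
  shows "smooth_on M (\<lambda>p. h (p $ 2) (p $ 3))"
proof -
  let ?\<pi> = "\<lambda>p::real^3. (p $ 2, p $ 3)"
  have "linear ?\<pi>" "?\<pi> ` Basis \<subseteq> insert 0 Basis"
    by (auto simp: linear_iff axis_def Basis_vec_def Basis_prod_def zero_prod_def split: if_splits)
  moreover have "surj ?\<pi>"
    by (rule surjI[of _ "\<lambda>(y, z). axis 2 y + axis 3 z"]) (auto simp: axis_def)
  ultimately have "smooth_on M (\<lambda>p. case ?\<pi> p of (y, z) \<Rightarrow> h y z)"
    using assms[unfolded yz_range_def] by (rule smooth_on_linear_compose)
  then show ?thesis by simp
qed

lemma partial_eq_0:
  assumes "open S" "p \<in> S" "\<forall>q\<in>S. u q = 0"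
  shows "partial i u p = 0"
  using partial_cong[OF assms] by simp

section \<open>Walker metrics\<close>

text \<open>\<open>matrix_inv\<close> is a choice of a two-sided inverse, and such an inverse is
  unique.\<close>

lemma matrix_inv_unique:
  fixes A :: "real ^ 'n ^ 'n"
  assumes "A ** B = mat 1" "B ** A = mat 1"
  shows "matrix_inv A = B"
proof -
  have "A ** matrix_inv A = mat 1 \<and> matrix_inv A ** A = mat 1"
    unfolding matrix_inv_def using assms by (intro someI[of "\<lambda>B. A ** B = mat 1 \<and> B ** A = mat 1"]) simp
  then show ?thesis
    using assms by (metis matrix_mul_assoc matrix_mul_lid matrix_mul_rid)
qed

lemma matrix_inv_walker_metric:
  assumes "\<epsilon> \<in> {1, - 1}"
  shows "matrix_inv (walker_metric \<epsilon> f p) =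
    vector [vector [- f p, 0, 1], vector [0, \<epsilon>, 0], vector [1, 0, 0]]"
  using assms
  by (intro matrix_inv_unique)
     (auto simp: walker_metric_def vec_eq_iff forall_3 matrix_matrix_mult_def sum_3 mat_def)

lemma partial_walker_metric:
  "partial i (\<lambda>q. walker_metric \<epsilon> f q $ j $ k) p = (if j = 3 \<and> k = 3 then partial i f p else 0)"
proof -
  have "\<forall>j k. partial i (\<lambda>q. walker_metric \<epsilon> f q $ j $ k) p
      = (if j = 3 \<and> k = 3 then partial i f p else 0)"
    by (simp add: forall_3 walker_metric_def)
  then show ?thesis by blast
qed

text \<open>Only the entry \<open>(3, 3)\<close> of the metric varies, so only derivatives of
  \<open>f\<close> survive. The equations are between functions, since \<open>riemann\<close>
  differentiates the symbols.\<close>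

lemma christoffel_walker_metric:
  assumes "\<epsilon> \<in> {1, - 1}"
  shows "christoffel (walker_metric \<epsilon> f) 1 i j = (\<lambda>p.
      if i = 3 then if j = 3 then (f p * partial 1 f p + partial 3 f p) / 2 else partial j f p / 2
      else if j = 3 then partial i f p / 2 else 0)"
    and "christoffel (walker_metric \<epsilon> f) 2 i j = (\<lambda>p. if i = 3 \<and> j = 3 then - \<epsilon> * partial 2 f p / 2 else 0)"
    and "christoffel (walker_metric \<epsilon> f) 3 i j = (\<lambda>p. if i = 3 \<and> j = 3 then - partial 1 f p / 2 else 0)"
  by (auto simp: fun_eq_iff christoffel_def matrix_inv_walker_metric[OF assms] partial_walker_metric sum_3 field_simps)

text \<open>The inverse metric has nonzero entries at most at \<open>(1, 1)\<close>,
  \<open>(2, 2)\<close>, \<open>(1, 3)\<close> and \<open>(3, 1)\<close>, so these four Ricci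
  components suffice; the last two contribute one half each.\<close>

lemma scalar_curvature_walker_metric:
  assumes M: "open M" "p \<in> M" and eps: "\<epsilon> \<in> {1, - 1}" and f: "smooth_on M f"
  shows "scalar_curvature (walker_metric \<epsilon> f) p = partial 1 (partial 1 f) p"
proof -
  have half: "partial i (\<lambda>q. partial j f q / 2) p = partial i (partial j f) p / 2"
    and minus_half: "partial i (\<lambda>q. - (partial j f q / 2)) p = - (partial i (partial j f) p / 2)" for i j
    using partial_cmult[OF M smooth_on_partial[OF f], of i "1/2" j]
      partial_cmult[OF M smooth_on_partial[OF f], of i "-1/2" j] by simp_all
  note simps = ricci_def riemann_def christoffel_walker_metric[OF eps] sum_3 half minus_half
  have "ricci (walker_metric \<epsilon> f) p $ 1 $ 1 = 0" "ricci (walker_metric \<epsilon> f) p $ 2 $ 2 = 0"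
    "ricci (walker_metric \<epsilon> f) p $ 1 $ 3 = partial 1 (partial 1 f) p / 2"
    "ricci (walker_metric \<epsilon> f) p $ 3 $ 1 = partial 1 (partial 1 f) p / 2"
    by (simp_all add: simps)
  then show ?thesis
    by (simp add: scalar_curvature_def matrix_inv_walker_metric[OF eps] sum_3)
qed

text \<open>For \<open>\<beta> = 0\<close> curvature enters only through the scalar curvature, and
  halving the equation gives Hessian equal to \<open>s\<close> times the metric. By symmetry of
  second derivatives six of the nine components remain.\<close>

lemma walker_soliton_iff:
  assumes M: "open M" and eps: "\<epsilon> \<in> {1, - 1}" and f: "smooth_on M f" and h: "smooth_on M h"
  shows "gradient_ricci_yamabe_soliton M (walker_metric \<epsilon> f) h 0 lam \<mu> \<longleftrightarrow>
    (\<forall>p\<in>M. let s = - lam + \<mu> / 2 * partial 1 (partial 1 f) p in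
      partial 1 (partial 1 h) p = 0 \<and>
      partial 1 (partial 2 h) p = 0 \<and>
      partial 2 (partial 2 h) p = \<epsilon> * s \<and>
      partial 1 (partial 3 h) p - 1/2 * partial 1 f p * partial 1 h p = s \<and>
      partial 2 (partial 3 h) p - 1/2 * partial 2 f p * partial 1 h p = 0 \<and>
      partial 3 (partial 3 h) p - 1/2 * (f p * partial 1 f p + partial 3 f p) * partial 1 h p
        + 1 / (2 * \<epsilon>) * partial 2 f p * partial 2 h p + 1/2 * partial 1 f p * partial 3 h p = s * f p)"
proof -
  have eps': "1 / (2 * \<epsilon>) = \<epsilon> / 2"
    using eps by auto
  have comm: "partial 2 (partial 1 h) p = partial 1 (partial 2 h) p"
    "partial 3 (partial 1 h) p = partial 1 (partial 3 h) p"
    "partial 3 (partial 2 h) p = partial 2 (partial 3 h) p" if "p \<in> M" for p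
    using partial_commute[OF M that h] by blast+
  show ?thesis
    unfolding gradient_ricci_yamabe_soliton_def eps'
    by (intro ball_cong refl)
       (auto simp: vec_eq_iff forall_3 hessian_def sum_3 christoffel_walker_metric[OF eps] comm
         scalar_curvature_walker_metric[OF M _ eps f] walker_metric_def Let_def field_simps)
qed

section \<open>Solving the potential equations without the component \<open>(3, 3)\<close>\<close>

context
  fixes M :: "(real ^ 3) set" and \<epsilon> lam :: real and f h :: "real ^ 3 \<Rightarrow> real"
  assumes M: "open M" "convex M" and eps: "\<epsilon> \<in> {1, - 1}"
    and f: "smooth_on M f" and h: "smooth_on M h"
    and nz: "\<And>p. p \<in> M \<Longrightarrow> partial 1 h p \<noteq> 0"
begin

lemmas smooth_rules = smooth_on_const smooth_on_nth smooth_on_partial f h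
  smooth_on_add[OF M(1)] smooth_on_diff[OF M(1)] smooth_on_minus[OF M(1)]
  smooth_on_mult[OF M(1)] smooth_on_divide[OF M(1)]

lemmas partial_rules = partial_add[OF M(1)] partial_diff[OF M(1)] partial_minus[OF M(1)]
  partial_mult[OF M(1)] partial_divide[OF M(1)] partial_nth

lemmas partial_cong_on_M = partial_cong[OF M(1)]
lemmas partial_eq_0_on_M = partial_eq_0[OF M(1)]
lemmas partial_of_z = partial_1_function_of_z[OF M(1)] partial_2_function_of_z[OF M(1)]
  partial_3_function_of_z[OF M(1)]
lemmas partial_of_yz = partial_1_function_of_yz[OF M(1)] partial_2_function_of_yz[OF M(1)]
  partial_3_function_of_yz[OF M(1)]

text \<open>The component \<open>(3, 3)\<close> is left out because the theorem carries it unchanged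
  on both sides. As \<open>partial 1 h\<close> has no zero, the components \<open>(1, 3)\<close> and
  \<open>(2, 3)\<close> can be solved for the derivatives of \<open>f\<close>.\<close>

lemma walker_potential_eqs_steady:
  "(\<forall>p\<in>M. partial 1 (partial 1 h) p = 0 \<and> partial 1 (partial 2 h) p = 0 \<and>
        partial 2 (partial 2 h) p = \<epsilon> * - lam \<and>
        partial 1 (partial 3 h) p - 1/2 * partial 1 f p * partial 1 h p = - lam \<and>
        partial 2 (partial 3 h) p - 1/2 * partial 2 f p * partial 1 h p = 0) \<longleftrightarrow>
    (\<exists>F a b c. smooth_on (z_range M) F \<and> smooth_on (z_range M) a \<and>
        smooth_on (z_range M) b \<and> smooth_on (z_range M) c \<and> (\<forall>z\<in>z_range M. F z \<noteq> 0) \<and>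
        (\<forall>p\<in>M. h p = F (p $ 3) * p $ 1 - \<epsilon> * lam / 2 * (p $ 2)\<^sup>2 + a (p $ 3) * p $ 2 + b (p $ 3) \<and>
          f p = (2 * p $ 2 * deriv a (p $ 3) + 2 * deriv b (p $ 3)) / F (p $ 3)
            + 2 * (lam + deriv F (p $ 3)) / F (p $ 3) * p $ 1 + c (p $ 3)))"
    (is "?eqs \<longleftrightarrow> ?form")
proof
  assume eqs: ?eqs
  have h11: "\<forall>p\<in>M. partial 1 (partial 1 h) p = 0" and h12: "\<forall>p\<in>M. partial 1 (partial 2 h) p = 0"
    and h22: "\<forall>p\<in>M. partial 2 (partial 2 h) p = - (\<epsilon> * lam)"
    and h21: "\<forall>p\<in>M. partial 2 (partial 1 h) p = 0"
    and f1: "\<forall>p\<in>M. partial 1 f p = 2 * (partial 1 (partial 3 h) p + lam) / partial 1 h p"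
    and f2: "\<forall>p\<in>M. partial 2 f p = 2 * partial 2 (partial 3 h) p / partial 1 h p"
    using eqs nz partial_commute[OF M(1) _ h, of _ 1 2] by (auto simp: field_simps)
  \<comment> \<open>The closed form of \<open>h\<close> solved for \<open>a\<close> and then for
    \<open>b\<close>. Squares are written as products to suit the product rule.\<close>
  define ua where "ua = (\<lambda>p. partial 2 h p + \<epsilon> * lam * p $ 2)"
  define ub where "ub = (\<lambda>p. h p - partial 1 h p * p $ 1 + \<epsilon> * lam / 2 * (p $ 2 * p $ 2) - ua p * p $ 2)"
  \<comment> \<open>In the closed form, \<open>partial 3 h\<close> collects the terms with
    \<open>deriv F\<close>, \<open>deriv a\<close> and \<open>deriv b\<close>, so \<open>f\<close>
    is \<open>2 * (partial 3 h p + lam * p $ 1) / partial 1 h p\<close> plus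
    \<open>c\<close>.\<close>
  define uc where "uc = (\<lambda>p. f p - 2 * (partial 3 h p + lam * p $ 1) / partial 1 h p)"
  have ua: "smooth_on M ua" and ub: "smooth_on M ub" and uc: "smooth_on M uc"
    unfolding ub_def ua_def uc_def by (simp_all add: smooth_rules nz)
  have ua12: "\<forall>p\<in>M. partial 1 ua p = 0" "\<forall>p\<in>M. partial 2 ua p = 0"
    and ua3: "\<forall>p\<in>M. partial 3 ua p = partial 3 (partial 2 h) p"
    unfolding ua_def by (simp_all add: partial_rules smooth_rules h12 h22)
  have ub12: "\<forall>p\<in>M. partial 1 ub p = 0" "\<forall>p\<in>M. partial 2 ub p = 0"
    and ub3: "\<forall>p\<in>M. partial 3 ub p
      = partial 3 h p - partial 3 (partial 1 h) p * p $ 1 - partial 3 (partial 2 h) p * p $ 2"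
    unfolding ub_def
    by (simp_all add: partial_rules smooth_rules ua ua12 ua3 h11 h21) (simp_all add: ua_def)
  have uc12: "\<forall>p\<in>M. partial 1 uc p = 0" "\<forall>p\<in>M. partial 2 uc p = 0"
    unfolding uc_def
    by (simp_all add: partial_rules smooth_rules nz h11 h21 f1 f2 power2_eq_square)
  obtain F where F: "smooth_on (z_range M) F" "\<forall>p\<in>M. partial 1 h p = F (p $ 3)"
    using descend_to_z[OF M smooth_on_partial[OF h] h11 h21] by blast
  obtain a where a: "smooth_on (z_range M) a" "\<forall>p\<in>M. ua p = a (p $ 3)"
    using descend_to_z[OF M ua ua12] by blast
  obtain b where b: "smooth_on (z_range M) b" "\<forall>p\<in>M. ub p = b (p $ 3)"
    using descend_to_z[OF M ub ub12] by blast
  obtain c where c: "smooth_on (z_range M) c" "\<forall>p\<in>M. uc p = c (p $ 3)"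
    using descend_to_z[OF M uc uc12] by blast
  have "h p = F (p $ 3) * p $ 1 - \<epsilon> * lam / 2 * (p $ 2)\<^sup>2 + a (p $ 3) * p $ 2 + b (p $ 3) \<and>
      f p = (2 * p $ 2 * deriv a (p $ 3) + 2 * deriv b (p $ 3)) / F (p $ 3)
        + 2 * (lam + deriv F (p $ 3)) / F (p $ 3) * p $ 1 + c (p $ 3)" if p: "p \<in> M" for p
  proof -
    have "deriv F (p $ 3) = partial 3 (partial 1 h) p" "deriv a (p $ 3) = partial 3 (partial 2 h) p"
      "deriv b (p $ 3) = partial 3 h p - partial 3 (partial 1 h) p * p $ 1 - partial 3 (partial 2 h) p * p $ 2"
      using partial_of_z(3)[OF p F(2)] partial_of_z(3)[OF p a(2)] partial_of_z(3)[OF p b(2)] ua3 ub3 p by simp_all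
    moreover have "F (p $ 3) = partial 1 h p" "a (p $ 3) = ua p" "b (p $ 3) = ub p" "c (p $ 3) = uc p"
      using F(2) a(2) b(2) c(2) p by simp_all
    ultimately show ?thesis
      using nz[OF p] by (simp add: ub_def uc_def power2_eq_square) (simp add: field_simps)
  qed
  moreover have "\<forall>z\<in>z_range M. F z \<noteq> 0"
    using nz F(2) by (auto simp: z_range_def)
  ultimately show ?form
    using F(1) a(1) b(1) c(1) by blast
next
  assume ?form
  then obtain F a b c where smooth: "smooth_on (z_range M) F" "smooth_on (z_range M) a"
      "smooth_on (z_range M) b" "smooth_on (z_range M) c"
    and h_eq: "\<forall>p\<in>M. h p = F (p $ 3) * p $ 1 - \<epsilon> * lam / 2 * (p $ 2 * p $ 2) + a (p $ 3) * p $ 2 + b (p $ 3)"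
    and f_eq: "\<forall>p\<in>M. f p = (2 * p $ 2 * deriv a (p $ 3) + 2 * deriv b (p $ 3)) / F (p $ 3)
        + 2 * (lam + deriv F (p $ 3)) / F (p $ 3) * p $ 1 + c (p $ 3)"
    by (auto simp: power2_eq_square)
  note sm = smooth[THEN smooth_on_function_of_z[OF M(1)]]
  note z = partial_of_z[where u = "\<lambda>p. k (p $ 3)" and h = k for k, simplified]
  have h1: "\<forall>p\<in>M. partial 1 h p = F (p $ 3)"
    and h2: "\<forall>p\<in>M. partial 2 h p = a (p $ 3) - \<epsilon> * lam * p $ 2"
    and h3: "\<forall>p\<in>M. partial 3 h p = deriv F (p $ 3) * p $ 1 + deriv a (p $ 3) * p $ 2 + deriv b (p $ 3)"
    by (simp_all add: partial_cong_on_M[OF _ h_eq] partial_rules smooth_rules sm z)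
  have h11: "\<forall>p\<in>M. partial 1 (partial 1 h) p = 0" and h12: "\<forall>p\<in>M. partial 1 (partial 2 h) p = 0"
    and h21: "\<forall>p\<in>M. partial 2 (partial 1 h) p = 0"
    and h22: "\<forall>p\<in>M. partial 2 (partial 2 h) p = - (\<epsilon> * lam)"
    by (simp_all add: partial_cong_on_M[OF _ h1] partial_cong_on_M[OF _ h2] partial_rules smooth_rules sm z)
  \<comment> \<open>Expressed through derivatives of \<open>h\<close>, the form of \<open>f\<close>
    can be differentiated using the smoothness of \<open>h\<close> and \<open>c\<close>, with no
    separate treatment of \<open>deriv a\<close> or \<open>deriv b\<close>.\<close>
  have f_eq': "\<forall>p\<in>M. f p = 2 * (partial 3 h p + lam * p $ 1) / partial 1 h p + c (p $ 3)"
    using f_eq nz h1 by (simp add: h3) (simp add: field_simps)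
  have "\<forall>p\<in>M. partial 1 f p = 2 * (partial 1 (partial 3 h) p + lam) / partial 1 h p"
    "\<forall>p\<in>M. partial 2 f p = 2 * partial 2 (partial 3 h) p / partial 1 h p"
    by (simp_all add: partial_cong_on_M[OF _ f_eq'] partial_rules smooth_rules sm z nz h11 h21 power2_eq_square)
  then show ?eqs
    using h11 h12 h22 nz by (simp add: field_simps)
qed

text \<open>Since \<open>\<mu>\<close> is nonzero, the component \<open>(2, 2)\<close> expresses
  \<open>partial 1 (partial 1 f)\<close> by derivatives of \<open>h\<close>, which makes
  \<open>f\<close> quadratic in \<open>x\<close>. The component \<open>(1, 3)\<close> stays in the
  closed form: it relates \<open>F4\<close> to \<open>F\<close> and forces the quadratic coefficient
  to vanish.\<close>

lemma walker_potential_eqs: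
  assumes \<mu>: "\<mu> \<noteq> 0"
  shows "(\<forall>p\<in>M. let s = - lam + \<mu> / 2 * partial 1 (partial 1 f) p in
        partial 1 (partial 1 h) p = 0 \<and> partial 1 (partial 2 h) p = 0 \<and>
        partial 2 (partial 2 h) p = \<epsilon> * s \<and>
        partial 1 (partial 3 h) p - 1/2 * partial 1 f p * partial 1 h p = s \<and>
        partial 2 (partial 3 h) p - 1/2 * partial 2 f p * partial 1 h p = 0) \<longleftrightarrow>
    (\<exists>F F4 F5 F2. smooth_on (z_range M) F \<and> smooth_on (z_range M) F4 \<and>
        smooth_on (z_range M) F5 \<and> smooth_on (yz_range M) (\<lambda>(y, z). F2 y z) \<and>
        (\<forall>z\<in>z_range M. F z \<noteq> 0) \<and>
        (\<forall>p\<in>M. h p = F (p $ 3) * p $ 1 + F2 (p $ 2) (p $ 3) \<and>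
          f p = 2 * deriv (\<lambda>t. F2 (p $ 2) t) (p $ 3) / F (p $ 3)
            + (\<epsilon> * lam + deriv (deriv (\<lambda>s. F2 s (p $ 3))) (p $ 2)) / (\<epsilon> * \<mu>) * (p $ 1)\<^sup>2
            + F4 (p $ 3) * p $ 1 + F5 (p $ 3) \<and>
          partial 1 (partial 3 h) p - 1/2 * partial 1 f p * partial 1 h p
            = - lam + \<mu> / 2 * partial 1 (partial 1 f) p))"
    (is "?eqs \<longleftrightarrow> ?form")
proof
  assume eqs: ?eqs
  have h11: "\<forall>p\<in>M. partial 1 (partial 1 h) p = 0" and h12: "\<forall>p\<in>M. partial 1 (partial 2 h) p = 0"
    and h22: "\<forall>p\<in>M. partial 2 (partial 2 h) p = \<epsilon> * (- lam + \<mu> / 2 * partial 1 (partial 1 f) p)"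
    and h13: "\<forall>p\<in>M. partial 1 (partial 3 h) p - 1/2 * partial 1 f p * partial 1 h p
      = - lam + \<mu> / 2 * partial 1 (partial 1 f) p"
    and h23: "\<forall>p\<in>M. partial 2 (partial 3 h) p - 1/2 * partial 2 f p * partial 1 h p = 0"
    using eqs unfolding Let_def by blast+
  have f2: "\<forall>p\<in>M. partial 2 f p = 2 * partial 2 (partial 3 h) p / partial 1 h p"
    using h23 nz by (simp add: field_simps)
  have h21: "\<forall>p\<in>M. partial 2 (partial 1 h) p = 0"
    using h12 partial_commute[OF M(1) _ h, of _ 1 2] by simp
  have h31: "\<forall>p\<in>M. partial 3 (partial 1 h) p = partial 1 (partial 3 h) p"
    using partial_commute[OF M(1) _ h] by blast
  have f11: "\<forall>p\<in>M. partial 1 (partial 1 f) p = 2 / \<mu> * (\<epsilon> * partial 2 (partial 2 h) p + lam)"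
    using \<mu> eps by (auto simp: h22 field_simps)
  \<comment> \<open>\<open>partial 1 h\<close> depends on \<open>z\<close> only, so each third
    derivative of \<open>h\<close> that contains an \<open>x\<close> and a further \<open>x\<close>
    or \<open>y\<close> vanishes. Four of these are needed.\<close>
  have h122: "\<forall>p\<in>M. partial 1 (partial 2 (partial 2 h)) p = 0"
    using partial_commute[OF M(1) _ smooth_on_partial[OF h], of _ 1 2 2] partial_eq_0_on_M[OF _ h12] by simp
  have f111: "\<forall>p\<in>M. partial 1 (partial 1 (partial 1 f)) p = 0"
    by (intro ballI, subst partial_cong_on_M[OF _ f11]) (simp_all add: partial_rules smooth_rules h122 \<mu>)
  have h131: "\<forall>p\<in>M. partial 1 (partial 3 (partial 1 h)) p = 0"
    and h231: "\<forall>p\<in>M. partial 2 (partial 3 (partial 1 h)) p = 0"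
    using partial_commute[OF M(1) _ smooth_on_partial[OF h], of _ 3 _ 1] partial_eq_0_on_M[OF _ h11] partial_eq_0_on_M[OF _ h21]
    by metis+
  have h123: "\<forall>p\<in>M. partial 1 (partial 2 (partial 3 h)) p = 0"
    using partial_commute[OF M(1) _ smooth_on_partial[OF h], of _ 1 2 3] partial_cong_on_M[OF _ h31, of _ 2] h231
    by metis
  \<comment> \<open>By \<open>f2\<close>, \<open>partial 2 f\<close> is a quotient whose numerator
    and denominator do not vary with \<open>x\<close>.\<close>
  have "\<forall>p\<in>M. partial 1 (partial 2 f) p = 0"
    by (intro ballI, subst partial_cong_on_M[OF _ f2]) (simp_all add: partial_rules smooth_rules nz h123 h11)
  then have f21: "\<forall>p\<in>M. partial 2 (partial 1 f) p = 0"
    using partial_commute[OF M(1) _ f, of _ 2 1] by simp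
  have f211: "\<forall>p\<in>M. partial 2 (partial 1 (partial 1 f)) p = 0"
    using partial_commute[OF M(1) _ smooth_on_partial[OF f], of _ 2 1 1] partial_eq_0_on_M[OF _ f21] by simp
  define u2 where "u2 = (\<lambda>p. h p - partial 1 h p * p $ 1)"
  \<comment> \<open>By \<open>f111\<close>, \<open>f\<close> is a quadratic polynomial in
    \<open>x\<close>. \<open>u4\<close> is its linear coefficient; \<open>u5\<close> is its constant
    term minus the term \<open>2 * partial 3 u2 p / partial 1 h p\<close>, which the closed form
    lists separately.\<close>
  define u4 where "u4 = (\<lambda>p. partial 1 f p - p $ 1 * partial 1 (partial 1 f) p)"
  define u5 where "u5 = (\<lambda>p. f p - p $ 1 * partial 1 f p + p $ 1 * p $ 1 * (partial 1 (partial 1 f) p / 2)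
      - 2 * (partial 3 h p - p $ 1 * partial 3 (partial 1 h) p) / partial 1 h p)"
  have u2: "smooth_on M u2" and u4: "smooth_on M u4" and u5: "smooth_on M u5"
    unfolding u2_def u4_def u5_def by (simp_all add: smooth_rules nz)
  have u2_1: "\<forall>p\<in>M. partial 1 u2 p = 0" and u2_2: "\<forall>p\<in>M. partial 2 u2 p = partial 2 h p"
    and u2_3: "\<forall>p\<in>M. partial 3 u2 p = partial 3 h p - p $ 1 * partial 3 (partial 1 h) p"
    unfolding u2_def by (simp_all add: partial_rules smooth_rules h11 h21)
  have u4_12: "\<forall>p\<in>M. partial 1 u4 p = 0" "\<forall>p\<in>M. partial 2 u4 p = 0"
    unfolding u4_def by (simp_all add: partial_rules smooth_rules f111 f21 f211)
  have u5_12: "\<forall>p\<in>M. partial 1 u5 p = 0" "\<forall>p\<in>M. partial 2 u5 p = 0"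
    unfolding u5_def
    by (simp_all add: partial_rules smooth_rules nz h11 h21 h131 h231 f111 f21 f211 h31 f2 power2_eq_square)
  obtain F where F: "smooth_on (z_range M) F" "\<forall>p\<in>M. partial 1 h p = F (p $ 3)"
    using descend_to_z[OF M smooth_on_partial[OF h] h11 h21] by blast
  obtain F4 where F4: "smooth_on (z_range M) F4" "\<forall>p\<in>M. u4 p = F4 (p $ 3)"
    using descend_to_z[OF M u4 u4_12] by blast
  obtain F5 where F5: "smooth_on (z_range M) F5" "\<forall>p\<in>M. u5 p = F5 (p $ 3)"
    using descend_to_z[OF M u5 u5_12] by blast
  obtain F2 where F2: "smooth_on (yz_range M) (\<lambda>(y, z). F2 y z)"
    "\<forall>p\<in>M. u2 p = F2 (p $ 2) (p $ 3)"
    using descend_to_yz[OF M u2 u2_1] by blast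
  \<comment> \<open>Stated on all of \<open>M\<close>, so that \<open>partial_of_yz\<close> applies
    once more and yields the second \<open>y\<close> derivative of \<open>F2\<close>.\<close>
  have F2_y: "\<forall>p\<in>M. partial 2 h p = deriv (\<lambda>s. F2 s (p $ 3)) (p $ 2)"
    using partial_of_yz(2)[OF _ F2(2)] u2_2 by simp
  have "h p = F (p $ 3) * p $ 1 + F2 (p $ 2) (p $ 3) \<and>
      f p = 2 * deriv (\<lambda>t. F2 (p $ 2) t) (p $ 3) / F (p $ 3)
        + (\<epsilon> * lam + deriv (deriv (\<lambda>s. F2 s (p $ 3))) (p $ 2)) / (\<epsilon> * \<mu>) * (p $ 1)\<^sup>2
        + F4 (p $ 3) * p $ 1 + F5 (p $ 3)" if p: "p \<in> M" for p
  proof -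
    have "deriv (\<lambda>t. F2 (p $ 2) t) (p $ 3) = partial 3 h p - p $ 1 * partial 3 (partial 1 h) p"
      "deriv (deriv (\<lambda>s. F2 s (p $ 3))) (p $ 2) = partial 2 (partial 2 h) p"
      using partial_of_yz(3)[OF p F2(2)] u2_3 p partial_of_yz(2)[OF p F2_y] by simp_all
    moreover have "F (p $ 3) = partial 1 h p" "F2 (p $ 2) (p $ 3) = u2 p" "F4 (p $ 3) = u4 p"
      "F5 (p $ 3) = u5 p"
      using F(2) F2(2) F4(2) F5(2) p by simp_all
    moreover have "(\<epsilon> * lam + partial 2 (partial 2 h) p) / (\<epsilon> * \<mu>) = partial 1 (partial 1 f) p / 2"
      using h22 p eps \<mu> by (auto simp: field_simps)
    ultimately show ?thesis
      by (simp only:) (simp add: u2_def u4_def u5_def power2_eq_square algebra_simps)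
  qed
  moreover have "\<forall>z\<in>z_range M. F z \<noteq> 0"
    using nz F(2) by (auto simp: z_range_def)
  ultimately show ?form
    using F(1) F4(1) F5(1) F2(1) h13 by blast
next
  assume ?form
  then obtain F F4 F5 F2 where smooth: "smooth_on (z_range M) F" "smooth_on (z_range M) F4"
      "smooth_on (z_range M) F5" and F2: "smooth_on (yz_range M) (\<lambda>(y, z). F2 y z)"
    and h_eq: "\<forall>p\<in>M. h p = F (p $ 3) * p $ 1 + F2 (p $ 2) (p $ 3)"
    and f_eq: "\<forall>p\<in>M. f p = 2 * deriv (\<lambda>t. F2 (p $ 2) t) (p $ 3) / F (p $ 3)
        + (\<epsilon> * lam + deriv (deriv (\<lambda>s. F2 s (p $ 3))) (p $ 2)) / (\<epsilon> * \<mu>) * (p $ 1)\<^sup>2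
        + F4 (p $ 3) * p $ 1 + F5 (p $ 3)"
    and h13: "\<forall>p\<in>M. partial 1 (partial 3 h) p - 1/2 * partial 1 f p * partial 1 h p
        = - lam + \<mu> / 2 * partial 1 (partial 1 f) p"
    by blast
  note sm = smooth[THEN smooth_on_function_of_z[OF M(1)]] smooth_on_function_of_yz[OF M(1) F2]
  note z = partial_of_z[where u = "\<lambda>p. k (p $ 3)" and h = k for k, simplified]
  note yz = partial_of_yz[where u = "\<lambda>p. F2 (p $ 2) (p $ 3)" and h = F2, simplified]
  have h1: "\<forall>p\<in>M. partial 1 h p = F (p $ 3)"
    and h2: "\<forall>p\<in>M. partial 2 h p = deriv (\<lambda>s. F2 s (p $ 3)) (p $ 2)"
    and h3: "\<forall>p\<in>M. partial 3 h p = deriv F (p $ 3) * p $ 1 + deriv (\<lambda>t. F2 (p $ 2) t) (p $ 3)"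
    by (simp_all add: partial_cong_on_M[OF _ h_eq] partial_rules smooth_rules sm z yz)
  have h11: "\<forall>p\<in>M. partial 1 (partial 1 h) p = 0" and h21: "\<forall>p\<in>M. partial 2 (partial 1 h) p = 0"
    and h31: "\<forall>p\<in>M. partial 3 (partial 1 h) p = deriv F (p $ 3)"
    by (simp_all add: partial_cong_on_M[OF _ h1] z)
  have h22: "\<forall>p\<in>M. partial 2 (partial 2 h) p = deriv (deriv (\<lambda>s. F2 s (p $ 3))) (p $ 2)"
    and h12: "\<forall>p\<in>M. partial 1 (partial 2 h) p = 0"
    using partial_of_yz(1,2)[OF _ h2] by simp_all
  have h13': "\<forall>p\<in>M. partial 1 (partial 3 h) p = partial 3 (partial 1 h) p"
    using partial_commute[OF M(1) _ h] by blast
  have h122: "\<forall>p\<in>M. partial 1 (partial 2 (partial 2 h)) p = 0"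
    using partial_commute[OF M(1) _ smooth_on_partial[OF h], of _ 1 2 2] partial_eq_0_on_M[OF _ h12] by simp
  have h131: "\<forall>p\<in>M. partial 1 (partial 3 (partial 1 h)) p = 0"
    and h231: "\<forall>p\<in>M. partial 2 (partial 3 (partial 1 h)) p = 0"
    using partial_commute[OF M(1) _ smooth_on_partial[OF h], of _ 3 _ 1] partial_eq_0_on_M[OF _ h11] partial_eq_0_on_M[OF _ h21]
    by metis+
  \<comment> \<open>The derivatives of \<open>F2\<close> are rewritten as derivatives of
    \<open>h\<close>, whose smoothness is known on \<open>M\<close>.\<close>
  have f_eq': "\<forall>p\<in>M. f p = 2 * (partial 3 h p - p $ 1 * partial 3 (partial 1 h) p) / partial 1 h p
      + (\<epsilon> * lam + partial 2 (partial 2 h) p) / (\<epsilon> * \<mu>) * (p $ 1 * p $ 1)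
      + F4 (p $ 3) * p $ 1 + F5 (p $ 3)"
    using f_eq by (simp add: h1 h3 h22 h31 power2_eq_square mult.commute)
  have nz': "\<epsilon> * \<mu> \<noteq> 0" using eps \<mu> by auto
  \<comment> \<open>The quotient in \<open>f_eq'\<close> drops out: the \<open>x\<close> derivative
    of its numerator cancels by \<open>h13'\<close> and \<open>h131\<close>, and its denominator is
    constant in \<open>x\<close>.\<close>
  have f1: "\<forall>p\<in>M. partial 1 f p = 2 * ((\<epsilon> * lam + partial 2 (partial 2 h) p) / (\<epsilon> * \<mu>)) * p $ 1 + F4 (p $ 3)"
    using nz' by (simp add: partial_cong_on_M[OF _ f_eq'] partial_rules smooth_rules sm z nz h11 h131 h122 h13')
      (simp add: power2_eq_square field_simps)
  have f11: "\<forall>p\<in>M. partial 1 (partial 1 f) p = 2 * ((\<epsilon> * lam + partial 2 (partial 2 h) p) / (\<epsilon> * \<mu>))"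
    using nz' by (simp add: partial_cong_on_M[OF _ f1] partial_rules smooth_rules sm z h122 power2_eq_square)
  have f111: "\<forall>p\<in>M. partial 1 (partial 1 (partial 1 f)) p = 0"
    using nz' by (simp add: partial_cong_on_M[OF _ f11] partial_rules smooth_rules h122)
  text \<open>The \<open>x\<close>-derivative of the equation \<open>h13\<close> reduces to \<open>\<partial>\<^sub>1\<partial>\<^sub>1f \<cdot> \<partial>\<^sub>1h = 0\<close>.
    Without this, the \<open>(2, 3)\<close> equation would not follow from the stated form of \<open>f\<close>.\<close>
  have f11_0: "\<forall>p\<in>M. partial 1 (partial 1 f) p = 0"
  proof
    fix p assume p: "p \<in> M"
    have "partial 1 (partial 1 f) p * partial 1 h p = 0"
      using partial_cong_on_M[OF p h13, of 1] partial_cong_on_M[OF p h13', of 1] p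
      by (auto simp: partial_rules smooth_rules h11 h131 f111)
    then show "partial 1 (partial 1 f) p = 0"
      using nz[OF p] by simp
  qed
  \<comment> \<open>Now \<open>s\<close> equals \<open>- lam\<close>, so this is the component
    \<open>(2, 2)\<close>.\<close>
  have h22_eq: "\<forall>p\<in>M. partial 2 (partial 2 h) p = - (\<epsilon> * lam)"
  proof
    fix p assume "p \<in> M"
    with f11_0 f11 nz' have "2 * (\<epsilon> * lam) + 2 * partial 2 (partial 2 h) p = 0"
      by simp
    then show "partial 2 (partial 2 h) p = - (\<epsilon> * lam)"
      by linarith
  qed
  \<comment> \<open>With the quadratic term gone, no third \<open>y\<close> derivative of
    \<open>h\<close> enters \<open>partial 2 f\<close>, and the component \<open>(2, 3)\<close>
    follows.\<close>
  have f_eq'': "\<forall>p\<in>M. f p = 2 * (partial 3 h p - p $ 1 * partial 3 (partial 1 h) p) / partial 1 h p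
      + F4 (p $ 3) * p $ 1 + F5 (p $ 3)"
    using f_eq' h22_eq by simp
  have "\<forall>p\<in>M. partial 2 f p = 2 * partial 2 (partial 3 h) p / partial 1 h p"
    by (simp add: partial_cong_on_M[OF _ f_eq''] partial_rules smooth_rules sm z nz h21 h231 power2_eq_square)
  then show ?eqs
    using h11 h12 h22_eq f11_0 h13 nz by (simp add: field_simps Let_def)
qed

end

section \<open>Classification of the solitons with \<open>\<beta> = 0\<close>\<close>

theorem theorem3p16:
  fixes M :: "(real ^ 3) set"
    and \<epsilon> lam :: real
    and f \<F> :: "real ^ 3 \<Rightarrow> real"
  assumes M: "open M" "convex M"
    and eps: "\<epsilon> \<in> {1, - 1}"
    and f_smooth: "smooth_on M f"
    and F_smooth: "smooth_on M \<F>"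
    and F_depends_on_x: "\<forall>p\<in>M. partial 1 \<F> p \<noteq> 0"
  shows
    "(gradient_ricci_yamabe_soliton M (walker_metric \<epsilon> f) \<F> 0 lam 0 \<longleftrightarrow>
       (\<exists>F a b c :: real \<Rightarrow> real.
          smooth_on (z_range M) F \<and> smooth_on (z_range M) a \<and>
          smooth_on (z_range M) b \<and> smooth_on (z_range M) c \<and>
          (\<forall>z\<in>z_range M. F z \<noteq> 0) \<and>
          (\<forall>p\<in>M. let x = p $ 1; y = p $ 2; z = p $ 3 in
             \<F> p = F z * x - \<epsilon> * lam / 2 * y\<^sup>2 + a z * y + b z \<and>
             f p = (2 * y * deriv a z + 2 * deriv b z) / F z
                   + 2 * (lam + deriv F z) / F z * x + c z \<and>
             partial 3 (partial 3 \<F>) p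
               - 1/2 * (f p * partial 1 f p + partial 3 f p) * partial 1 \<F> p
               + 1 / (2 * \<epsilon>) * partial 2 f p * partial 2 \<F> p
               + 1/2 * partial 1 f p * partial 3 \<F> p
             = - lam * f p)))
     \<and>
     (\<forall>\<mu>::real. \<mu> \<noteq> 0 \<longrightarrow>
       (gradient_ricci_yamabe_soliton M (walker_metric \<epsilon> f) \<F> 0 lam \<mu> \<longleftrightarrow>
         (\<exists>(F :: real \<Rightarrow> real) (F4 :: real \<Rightarrow> real) (F5 :: real \<Rightarrow> real)
            (F2 :: real \<Rightarrow> real \<Rightarrow> real).
            smooth_on (z_range M) F \<and> smooth_on (z_range M) F4 \<and>
            smooth_on (z_range M) F5 \<and> smooth_on (yz_range M) (\<lambda>(y, z). F2 y z) \<and>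
            (\<forall>z\<in>z_range M. F z \<noteq> 0) \<and>
            (\<forall>p\<in>M. let x = p $ 1; y = p $ 2; z = p $ 3 in
               \<F> p = F z * x + F2 y z \<and>
               f p = 2 * deriv (\<lambda>t. F2 y t) z / F z
                     + (\<epsilon> * lam + deriv (deriv (\<lambda>s. F2 s z)) y) / (\<epsilon> * \<mu>) * x\<^sup>2
                     + F4 z * x + F5 z \<and>
               partial 1 (partial 3 \<F>) p - 1/2 * partial 1 f p * partial 1 \<F> p
                 = - lam + \<mu> / 2 * partial 1 (partial 1 f) p \<and>
               partial 3 (partial 3 \<F>) p
                 - 1/2 * (f p * partial 1 f p + partial 3 f p) * partial 1 \<F> p
                 + 1 / (2 * \<epsilon>) * partial 2 f p * partial 2 \<F> p
                 + 1/2 * partial 1 f p * partial 3 \<F> p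
               = (- lam + \<mu> / 2 * partial 1 (partial 1 f) p) * f p))))"
proof -
  note forms = M eps f_smooth F_smooth bspec[OF F_depends_on_x]
  \<comment> \<open>Separates the component \<open>(3, 3)\<close>, in the role of \<open>G\<close>,
    from the five that the potential lemmas treat.\<close>
  have split: "(\<forall>p\<in>M. let s = S p in A p \<and> B p \<and> C s p \<and> D s p \<and> E p \<and> G s p) \<longleftrightarrow>
      (\<forall>p\<in>M. let s = S p in A p \<and> B p \<and> C s p \<and> D s p \<and> E p) \<and> (\<forall>p\<in>M. G (S p) p)"
    for A B C D E G and S :: "real ^ 3 \<Rightarrow> real"
    by (auto simp: Let_def)
  note iff = walker_soliton_iff[OF M(1) eps f_smooth F_smooth, unfolded split]
  have steady: "- lam + 0 / 2 * t = - lam" for t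
    by simp
  show ?thesis
  proof (intro conjI allI impI, goal_cases)
    case 1
    show ?case
      \<comment> \<open>The component \<open>(3, 3)\<close> mentions none of the witnesses, so it
        moves freely under the existential quantifiers.\<close>
      unfolding iff steady Let_def using walker_potential_eqs_steady[OF forms, of lam]
      by (simp only: ball_conj_distrib ex_simps(1)[symmetric] conj_assoc)
  next
    case (2 \<mu>)
    show ?case
      unfolding iff Let_def using walker_potential_eqs[OF forms 2, of lam, unfolded Let_def]
      by (simp only: ball_conj_distrib ex_simps(1)[symmetric] conj_assoc)
  qed
qed

end
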